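(* Let $m\ge2$, let $H$ be a complex Hilbert space, and let $E$ be a POVM on $\Omega_m=\{0,\dots,m-1\}^{\mathbb N}$ with values in $B(H)$. For every bounded self-adjoint range martingale $X=\{X_w\}$ for $E$ and every finite word $w$, the local variance $$\Gamma_w(X)=\sum_{j=0}^{m-1}C_{wj}^*X_{wj}^2C_{wj}-X_w^2$$ satisfies $\Gamma_w(X)\ge0$. More explicitly, $$\Gamma_w(X)=J_w^*Y_w(I-J_wJ_w^* )Y_wJ_w,$$ where $J_w:H_w\to\bigoplus_{j=0}^{m-1}H_{wj}$ is the isometry $J_wx=(C_{w0}x,\dots,C_{w,m-1}x)$ and $Y_w=\bigoplus_{j=0}^{m-1}X_{wj}$ on $\bigoplus_{j=0}^{m-1}H_{wj}$.
   Context: $\Omega_m$ carries its product Borel $\sigma$-algebra $\mathcal B(\Omega_m)$. For a finite word $w=w_1\cdots w_n$ in $\{0,\dots,m-1\}$, $[w]=\{x\in\Omega_m:x_1=w_1,\dots,x_n=w_n\}$; the empty word is $\varnothing$, and $[\varnothing]=\Omega_m$; $wj$ is $w$ with the letter $j$ appended. A POVM on $\Omega_m$ with values in $B(H)$ is a map $E:\mathcal B(\Omega_m)\to B(H)_+$ that is countably additive in the weak operator topology and satisfies $E(\Omega_m)=I$. Put $E_w=E([w])$ and $H_w=\overline{\operatorname{ran}}(E_w^{1/2})$. For $0\le j\le m-1$, the edge contraction $C_{wj}:H_w\to H_{wj}$ (also written $C_{w,j}$) is the unique contraction with $C_{wj}E_w^{1/2}h=E_{wj}^{1/2}h$ for all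 $h\in H$. A bounded (self-adjoint) range martingale for $E$ is a family of self-adjoint operators $X_w\in B(H_w)$, indexed by all finite words $w$, such that $\sup_w\|X_w\|<\infty$ and $X_w=\sum_{j=0}^{m-1}C_{wj}^*X_{wj}C_{wj}$ for every $w$. *)

theory Defs
  imports "HOL-Analysis.Analysis" "HOL-Library.Function_Algebras" "HOL-Library.FuncSet"
begin

section \<open>Complex Hilbert spaces\<close>

class complex_vector = ab_group_add +
  fixes scaleC :: "complex \<Rightarrow> 'a \<Rightarrow> 'a"  (infixr \<open>*\<^sub>C\<close> 75)
  assumes scaleC_add_right: "a *\<^sub>C (x + y) = a *\<^sub>C x + a *\<^sub>C y"
    and scaleC_add_left: "(a + b) *\<^sub>C x = a *\<^sub>C x + b *\<^sub>C x"
    and scaleC_scaleC: "a *\<^sub>C (b *\<^sub>C x) = (a * b) *\<^sub>C x"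
    and scaleC_one: "1 *\<^sub>C x = x"

text \<open>The inner product is linear in the first argument and conjugate linear in the second.
  The real Banach space structure supplies the topology and completeness; its scalar
  multiplication and norm are those induced by the complex structure.\<close>

class chilbert_space = banach + complex_vector +
  fixes cinner :: "'a \<Rightarrow> 'a \<Rightarrow> complex"
  assumes scaleR_scaleC: "scaleR r x = complex_of_real r *\<^sub>C x"
    and cinner_commute: "cinner x y = cnj (cinner y x)"
    and cinner_add_left: "cinner (x + y) z = cinner x z + cinner y z"
    and cinner_scaleC_left: "cinner (a *\<^sub>C x) y = a * cinner x y"
    and cinner_self: "cinner x x = complex_of_real ((norm x)\<^sup>2)"

instantiation "fun" :: (type, complex_vector) complex_vector
begin

definition scaleC_fun_def: "a *\<^sub>C f = (\<lambda>i. a *\<^sub>C f i)"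

instance
  by standard
    (auto simp: scaleC_fun_def plus_fun_def fun_eq_iff
      scaleC_add_right scaleC_add_left scaleC_scaleC scaleC_one)

end


section \<open>Operators between closed subspaces\<close>

text \<open>An operator from a subspace \<open>U\<close> to a subspace \<open>V\<close> is a function on the ambient types of
  which only the values on \<open>U\<close> matter.\<close>

definition clinear_between ::
  "'a::complex_vector set \<Rightarrow> 'b::complex_vector set \<Rightarrow> ('a \<Rightarrow> 'b) \<Rightarrow> bool" where
  "clinear_between U V T \<longleftrightarrow>
     (\<forall>x\<in>U. T x \<in> V) \<and>
     (\<forall>x\<in>U. \<forall>y\<in>U. T (x + y) = T x + T y) \<and>
     (\<forall>a. \<forall>x\<in>U. T (a *\<^sub>C x) = a *\<^sub>C T x)"

definition bounded_between ::
  "'a::chilbert_space set \<Rightarrow> 'b::chilbert_space set \<Rightarrow> ('a \<Rightarrow> 'b) \<Rightarrow> bool" where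
  "bounded_between U V T \<longleftrightarrow>
     clinear_between U V T \<and> (\<exists>K. \<forall>x\<in>U. norm (T x) \<le> K * norm x)"

definition contraction_between ::
  "'a::chilbert_space set \<Rightarrow> 'b::chilbert_space set \<Rightarrow> ('a \<Rightarrow> 'b) \<Rightarrow> bool" where
  "contraction_between U V T \<longleftrightarrow>
     clinear_between U V T \<and> (\<forall>x\<in>U. norm (T x) \<le> norm x)"

text \<open>Operator norm of the restriction of \<open>T\<close> to \<open>U\<close>.\<close>

definition onorm_on :: "'a::chilbert_space set \<Rightarrow> ('a \<Rightarrow> 'b::chilbert_space) \<Rightarrow> real" where
  "onorm_on U T = (SUP x\<in>U. norm (T x) / norm x)"

text \<open>The inner products are parameters, so that \<open>U\<close> and \<open>V\<close> may also be direct sums, whose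
  ambient type carries no inner product.\<close>

definition isometry_between ::
  "'a::complex_vector set \<Rightarrow> ('a \<Rightarrow> 'a \<Rightarrow> complex) \<Rightarrow>
   'b::complex_vector set \<Rightarrow> ('b \<Rightarrow> 'b \<Rightarrow> complex) \<Rightarrow> ('a \<Rightarrow> 'b) \<Rightarrow> bool" where
  "isometry_between U ipU V ipV T \<longleftrightarrow>
     clinear_between U V T \<and> (\<forall>x\<in>U. ipV (T x) (T x) = ipU x x)"

definition hadjoint ::
  "'a set \<Rightarrow> ('a \<Rightarrow> 'a \<Rightarrow> complex) \<Rightarrow> ('b \<Rightarrow> 'b \<Rightarrow> complex) \<Rightarrow> ('a \<Rightarrow> 'b) \<Rightarrow> 'b \<Rightarrow> 'a" where
  "hadjoint U ipU ipV T y = (THE z. z \<in> U \<and> (\<forall>x\<in>U. ipV (T x) y = ipU x z))"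

definition selfadjoint_on :: "'a::chilbert_space set \<Rightarrow> ('a \<Rightarrow> 'a) \<Rightarrow> bool" where
  "selfadjoint_on U T \<longleftrightarrow>
     bounded_between U U T \<and> (\<forall>x\<in>U. hadjoint U cinner cinner T x = T x)"

definition positive_on :: "'a::chilbert_space set \<Rightarrow> ('a \<Rightarrow> 'a) \<Rightarrow> bool" where
  "positive_on U T \<longleftrightarrow>
     bounded_between U U T \<and> (\<forall>x\<in>U. cinner (T x) x \<in> \<real>\<^sub>\<ge>\<^sub>0)"

text \<open>The positive square root of a positive operator; it exists and is unique, so the choice
  operator selects it.\<close>

definition op_sqrt :: "('a::chilbert_space \<Rightarrow> 'a) \<Rightarrow> 'a \<Rightarrow> 'a" where
  "op_sqrt T = (SOME S. positive_on UNIV S \<and> S \<circ> S = T)"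

text \<open>The Hilbert direct sum of \<open>V 0, \<dots>, V (m - 1)\<close>: families extended by zero beyond \<open>m\<close>.\<close>

definition dsum :: "nat \<Rightarrow> (nat \<Rightarrow> 'a::zero set) \<Rightarrow> (nat \<Rightarrow> 'a) set" where
  "dsum m V = {z. (\<forall>j<m. z j \<in> V j) \<and> (\<forall>j\<ge>m. z j = 0)}"

definition dsum_inner :: "nat \<Rightarrow> (nat \<Rightarrow> 'a::chilbert_space) \<Rightarrow> (nat \<Rightarrow> 'a) \<Rightarrow> complex" where
  "dsum_inner m y z = (\<Sum>j<m. cinner (y j) (z j))"


section \<open>POVMs on the shift space\<close>

text \<open>\<open>{0, \<dots>, m - 1}\<^sup>\<nat>\<close> with its product Borel \<open>\<sigma>\<close>-algebra; its space consists of all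
  sequences with entries below \<open>m\<close>. Coordinates are numbered from \<open>0\<close>.\<close>

definition Omega :: "nat \<Rightarrow> (nat \<Rightarrow> nat) measure" where
  "Omega m = (\<Pi>\<^sub>M i\<in>UNIV. count_space {..<m})"

definition words :: "nat \<Rightarrow> nat list set" where
  "words m = lists {..<m}"

definition cylinder :: "nat \<Rightarrow> nat list \<Rightarrow> (nat \<Rightarrow> nat) set" where
  "cylinder m w = {x \<in> space (Omega m). \<forall>i<length w. x i = w ! i}"

definition povm :: "nat \<Rightarrow> ((nat \<Rightarrow> nat) set \<Rightarrow> 'h::chilbert_space \<Rightarrow> 'h) \<Rightarrow> bool" where
  "povm m E \<longleftrightarrow>
     (\<forall>A\<in>sets (Omega m). positive_on UNIV (E A)) \<and>
     (\<forall>A :: nat \<Rightarrow> (nat \<Rightarrow> nat) set. range A \<subseteq> sets (Omega m) \<and> disjoint_family A \<longrightarrow>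
        (\<forall>x y. (\<lambda>n. cinner (E (A n) x) y) sums cinner (E (\<Union>n. A n) x) y)) \<and>
     E (space (Omega m)) = id"


section \<open>Range martingales\<close>

context
  fixes m :: nat and E :: "(nat \<Rightarrow> nat) set \<Rightarrow> 'h::chilbert_space \<Rightarrow> 'h"
begin

definition sqrtE :: "nat list \<Rightarrow> 'h \<Rightarrow> 'h" where
  "sqrtE w = op_sqrt (E (cylinder m w))"

definition range_space :: "nat list \<Rightarrow> 'h set" where
  "range_space w = closure (range (sqrtE w))"

text \<open>Requiring extensionality makes the contraction unique as a function on the ambient type.\<close>

definition edge :: "nat list \<Rightarrow> nat \<Rightarrow> 'h \<Rightarrow> 'h" where
  "edge w j = (THE C. C \<in> extensional (range_space w) \<and>
     contraction_between (range_space w) (range_space (w @ [j])) C \<and>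
     (\<forall>h. C (sqrtE w h) = sqrtE (w @ [j]) h))"

definition edge_adj :: "nat list \<Rightarrow> nat \<Rightarrow> 'h \<Rightarrow> 'h" where
  "edge_adj w j = hadjoint (range_space w) cinner cinner (edge w j)"

definition bounded_range_martingale :: "(nat list \<Rightarrow> 'h \<Rightarrow> 'h) \<Rightarrow> bool" where
  "bounded_range_martingale X \<longleftrightarrow>
     (\<forall>w\<in>words m. selfadjoint_on (range_space w) (X w)) \<and>
     bdd_above ((\<lambda>w. onorm_on (range_space w) (X w)) ` words m) \<and>
     (\<forall>w\<in>words m. \<forall>x\<in>range_space w.
        X w x = (\<Sum>j<m. edge_adj w j (X (w @ [j]) (edge w j x))))"

definition local_variance :: "(nat list \<Rightarrow> 'h \<Rightarrow> 'h) \<Rightarrow> nat list \<Rightarrow> 'h \<Rightarrow> 'h" where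
  "local_variance X w x =
     (\<Sum>j<m. edge_adj w j (X (w @ [j]) (X (w @ [j]) (edge w j x)))) - X w (X w x)"

definition child_sum :: "nat list \<Rightarrow> (nat \<Rightarrow> 'h) set" where
  "child_sum w = dsum m (\<lambda>j. range_space (w @ [j]))"

definition J_op :: "nat list \<Rightarrow> 'h \<Rightarrow> nat \<Rightarrow> 'h" where
  "J_op w x = (\<lambda>j. if j < m then edge w j x else 0)"

definition J_adj :: "nat list \<Rightarrow> (nat \<Rightarrow> 'h) \<Rightarrow> 'h" where
  "J_adj w = hadjoint (range_space w) cinner (dsum_inner m) (J_op w)"

definition Y_op :: "(nat list \<Rightarrow> 'h \<Rightarrow> 'h) \<Rightarrow> nat list \<Rightarrow> (nat \<Rightarrow> 'h) \<Rightarrow> nat \<Rightarrow> 'h" where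
  "Y_op X w z = (\<lambda>j. if j < m then X (w @ [j]) (z j) else 0)"

end

end

theory Submission
  imports Defs
begin

text \<open>
  The measure is additive on the cylinders \<open>[w] = \<Union>\<^sub>j [wj]\<close>, so
  \<open>\<parallel>E\<^sub>w\<^sup>1\<^sup>/\<^sup>2 h\<parallel>\<^sup>2 = \<Sum>\<^sub>j \<parallel>E\<^sub>w\<^sub>j\<^sup>1\<^sup>/\<^sup>2 h\<parallel>\<^sup>2\<close>. Hence the edge contractions
  exist and \<open>\<Sum>\<^sub>j \<parallel>C\<^sub>w\<^sub>j x\<parallel>\<^sup>2 = \<parallel>x\<parallel>\<^sup>2\<close>, first on the dense range of \<open>E\<^sub>w\<^sup>1\<^sup>/\<^sup>2\<close> and then on its
  closure (\<open>edge_norm_sum\<close>); that is, \<open>J\<close> is an isometry.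
  Since \<open>J\<^sup>* z = \<Sum>\<^sub>j C\<^sub>w\<^sub>j\<^sup>* z\<^sub>j\<close> (\<open>J_adj_eq\<close>), the martingale property reads
  \<open>X\<^sub>w = J\<^sup>* Y J\<close>, and the local variance is
  \<open>J\<^sup>* Y\<^sup>2 J - J\<^sup>* Y J J\<^sup>* Y J = J\<^sup>* Y (I - J J\<^sup>*) Y J\<close>. Its quadratic form at \<open>x\<close> is
  \<open>\<parallel>Y J x\<parallel>\<^sup>2 - \<parallel>X\<^sub>w x\<parallel>\<^sup>2 = \<parallel>Y J x - J X\<^sub>w x\<parallel>\<^sup>2\<close>, which is nonnegative.

  The operators in this argument are given by choice and description operators. Three existence
  theorems for Hilbert spaces show that these descriptions are met: every positive bounded operator has
  a positive square root (\<open>sqrt_exists\<close>, by an iteration with a scalar majorant),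
  bounded functionals on a closed subspace are represented by vectors of it
  (\<open>riesz_representation\<close>, which yields adjoints), and \<open>S h \<mapsto> T h\<close> extends
  to a contraction on the closure of the range of \<open>S\<close> whenever \<open>\<parallel>T h\<parallel> \<le> \<parallel>S h\<parallel>\<close>
  (\<open>contraction_extension\<close>).
\<close>

section \<open>Inner product and norm\<close>

lemma scaleC_zero_right [simp]: "a *\<^sub>C (0::'a::complex_vector) = 0"
  using scaleC_add_right[of a 0 "0::'a"] by simp

lemma scaleC_zero_left [simp]: "0 *\<^sub>C (x::'a::complex_vector) = 0"
  using scaleC_add_left[of 0 0 x] by simp

lemma scaleC_minus_one: "(-1) *\<^sub>C (x::'a::complex_vector) = - x"
proof -
  have "(-1) *\<^sub>C x + x = ((-1) + 1) *\<^sub>C x"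
    by (simp only: scaleC_add_left scaleC_one)
  then show ?thesis
    by (simp add: eq_neg_iff_add_eq_0)
qed

lemma scaleC_diff_right: "a *\<^sub>C (x - y) = a *\<^sub>C x - a *\<^sub>C (y::'a::complex_vector)"
  using scaleC_add_right[of a "x - y" y] by (simp add: algebra_simps)

lemma cinner_add_right: "cinner (x::'a::chilbert_space) (y + z) = cinner x y + cinner x z"
  by (metis cinner_add_left cinner_commute complex_cnj_add)

lemma cinner_scaleC_right: "cinner (x::'a::chilbert_space) (a *\<^sub>C y) = cnj a * cinner x y"
  by (metis cinner_scaleC_left cinner_commute complex_cnj_mult)

lemma cinner_scaleR_left: "cinner (r *\<^sub>R x) (y::'a::chilbert_space) = r *\<^sub>R cinner x y"
  by (simp add: scaleR_scaleC cinner_scaleC_left scaleR_conv_of_real)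

lemma cinner_scaleR_right: "cinner x (r *\<^sub>R (y::'a::chilbert_space)) = r *\<^sub>R cinner x y"
  by (simp add: scaleR_scaleC cinner_scaleC_right scaleR_conv_of_real)

lemma norm_scaleC: "norm (a *\<^sub>C (x::'a::chilbert_space)) = cmod a * norm x"
proof -
  have "complex_of_real ((norm (a *\<^sub>C x))\<^sup>2) = a * cnj a * complex_of_real ((norm x)\<^sup>2)"
    by (simp only: cinner_self[symmetric] cinner_scaleC_left cinner_scaleC_right mult.assoc mult.left_commute)
  also have "\<dots> = complex_of_real ((cmod a * norm x)\<^sup>2)"
    by (simp only: complex_norm_square[symmetric] power_mult_distrib of_real_mult)
  finally show ?thesis
    by (metis of_real_eq_iff power2_eq_iff_nonneg mult_nonneg_nonneg norm_ge_zero)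
qed

lemma bounded_linear_scaleC: "bounded_linear (scaleC a :: 'a::chilbert_space \<Rightarrow> 'a)"
  by (rule bounded_linear_intro[where K = "cmod a"])
    (auto simp: scaleC_add_right scaleR_scaleC scaleC_scaleC norm_scaleC mult.commute)

lemma Re_cinner_self: "Re (cinner x x) = (norm (x::'a::chilbert_space))\<^sup>2"
  by (simp add: cinner_self)

lemma Re_cinner_commute: "Re (cinner x y) = Re (cinner (y::'a::chilbert_space) x)"
  by (metis cinner_commute cnj.simps(1))

lemma norm_add_square:
  "(norm (x + y))\<^sup>2 = (norm x)\<^sup>2 + 2 * Re (cinner x y) + (norm (y::'a::chilbert_space))\<^sup>2"
  unfolding Re_cinner_self[symmetric]
  by (simp add: cinner_add_left cinner_add_right Re_cinner_commute[of y x])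

lemma norm_diff_square:
  "(norm (x - y))\<^sup>2 = (norm x)\<^sup>2 - 2 * Re (cinner x y) + (norm (y::'a::chilbert_space))\<^sup>2"
proof -
  have "cinner x (- y) = - cinner x y"
    using cinner_scaleR_right[of x "-1" y] by simp
  then show ?thesis
    using norm_add_square[of x "- y"] by simp
qed

lemma cauchy_schwarz: "cmod (cinner x y) \<le> norm x * norm (y::'a::chilbert_space)"
proof (cases "y = 0")
  case True
  then show ?thesis
    using cinner_scaleC_right[of x 0 y] by simp
next
  case False
  define n where "n = (norm y)\<^sup>2"
  have n: "n > 0" using False by (simp add: n_def)
  define c where "c = cinner x y / complex_of_real n"
  \<comment> \<open>\<open>c *\<^sub>C y\<close> is the orthogonal projection of \<open>x\<close> to the line through \<open>y\<close>.\<close>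
  have "Re (cinner x (c *\<^sub>C y)) = (cmod (cinner x y))\<^sup>2 / n"
    by (simp add: c_def cinner_scaleC_right mult.commute
        flip: complex_norm_square of_real_power of_real_divide)
  moreover have "(norm (c *\<^sub>C y))\<^sup>2 = (cmod (cinner x y))\<^sup>2 / n"
    using n by (simp add: c_def norm_scaleC norm_divide power_mult_distrib power_divide flip: n_def)
      (simp add: power2_eq_square)
  ultimately have "(cmod (cinner x y))\<^sup>2 / n \<le> (norm x)\<^sup>2"
    using norm_diff_square[of x "c *\<^sub>C y"] zero_le_power2[of "norm (x - c *\<^sub>C y)"] by linarith
  then have "(cmod (cinner x y))\<^sup>2 \<le> (norm x * norm y)\<^sup>2"
    using n by (simp add: divide_le_eq power_mult_distrib n_def)
  then show ?thesis
    by (rule power2_le_imp_le) simp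
qed

interpretation cinner: bounded_bilinear "cinner :: 'a::chilbert_space \<Rightarrow> 'a \<Rightarrow> complex"
proof
  show "\<exists>K. \<forall>(a::'a) b. cmod (cinner a b) \<le> norm a * norm b * K"
    by (rule exI[of _ 1]) (simp add: cauchy_schwarz)
qed (simp_all add: cinner_add_left cinner_add_right cinner_scaleR_left cinner_scaleR_right)

lemma cnj_cinner: "cnj (cinner x y) = cinner (y::'a::chilbert_space) x"
  by (metis cinner_commute)

section \<open>Positive square roots\<close>

text \<open>Complex polarization: the form of \<open>T\<close> is real at \<open>x + y\<close> and at \<open>x + \<i> *\<^sub>C y\<close>.\<close>

lemma positive_symmetric:
  fixes T :: "'a::chilbert_space \<Rightarrow> 'a"
  assumes "positive_on UNIV T"
  shows "cinner (T x) y = cinner x (T y)"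
proof -
  have add: "T (x + y) = T x + T y" and scale: "T (a *\<^sub>C x) = a *\<^sub>C T x"
    and real: "Im (cinner (T x) x) = 0" for x y a
    using assms by (auto simp: positive_on_def bounded_between_def clinear_between_def
        complex_nonneg_Reals_iff)
  have "Im (cinner (T x) y + cinner (T y) x) = 0"
    using real[of "x + y"] real[of x] real[of y] by (simp add: add cinner_add_left cinner_add_right)
  moreover have "Re (cinner (T x) y) = Re (cinner (T y) x)"
    using real[of "x + \<i> *\<^sub>C y"] real[of x] real[of y]
    by (simp add: add scale cinner_add_left cinner_add_right cinner_scaleC_left cinner_scaleC_right)
  ultimately have "cinner (T x) y = cnj (cinner (T y) x)"
    by (auto simp: complex_eq_iff)
  then show ?thesis
    by (simp add: cnj_cinner)
qed

text \<open>For a contraction \<open>0 \<le> T\<close> this is the operator inequality \<open>T\<^sup>2 \<le> T\<close>. It follows from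
  positivity of the form of \<open>T\<close> at \<open>x - T x\<close>, so it needs no square root of \<open>T\<close>.\<close>

lemma positive_norm_square_le:
  fixes T :: "'a::chilbert_space \<Rightarrow> 'a"
  assumes pos: "positive_on UNIV T" and contr: "\<And>x. norm (T x) \<le> norm x"
  shows "(norm (T x))\<^sup>2 \<le> Re (cinner (T x) x)"
proof -
  have T: "T (x + y) = T x + T y" "T (a *\<^sub>C x) = a *\<^sub>C T x" "0 \<le> Re (cinner (T x) x)" for x y a
    using pos by (auto simp: positive_on_def bounded_between_def clinear_between_def
        complex_nonneg_Reals_iff)
  have diff: "T (x - y) = T x - T y" for x y
    using T(1)[of "x - y" y] by (simp add: algebra_simps)
  have "Re (cinner (T (T x)) (T x)) \<le> norm (T (T x)) * norm (T x)"
    using cauchy_schwarz complex_Re_le_cmod order_trans by blast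
  also have "\<dots> \<le> (norm (T x))\<^sup>2"
    using contr[of "T x"] by (simp add: power2_eq_square mult_right_mono)
  finally have "Re (cinner (T (T x)) (T x)) \<le> (norm (T x))\<^sup>2" .
  moreover have "cinner (T (T x)) x = cinner (T x) (T x)"
    by (rule positive_symmetric[OF pos])
  ultimately show ?thesis
    using T(3)[of "x - T x"] by (simp add: diff cinner.diff_left cinner.diff_right Re_cinner_self)
qed

text \<open>If \<open>R\<close> solves \<open>R = (A + R\<^sup>2) / 2\<close>, then \<open>(I - R)\<^sup>2 = I - A\<close>. The following iteration,
  started at \<open>0\<close>, approximates such an \<open>R\<close>.\<close>

fun sqrt_iter :: "('a::real_vector \<Rightarrow> 'a) \<Rightarrow> nat \<Rightarrow> 'a \<Rightarrow> 'a" where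
  "sqrt_iter A 0 x = 0"
| "sqrt_iter A (Suc n) x = (1 / 2) *\<^sub>R (A x + sqrt_iter A n (sqrt_iter A n x))"

text \<open>The scalar case \<open>A = 1\<close> of the iteration. When \<open>A\<close> is a contraction, it dominates the norms
  of the operator iterates and of their successive differences.\<close>

fun sqrt_majorant :: "nat \<Rightarrow> real" where
  "sqrt_majorant 0 = 0"
| "sqrt_majorant (Suc n) = (1 + (sqrt_majorant n)\<^sup>2) / 2"

lemma sqrt_majorant_bounds: "0 \<le> sqrt_majorant n \<and> sqrt_majorant n \<le> 1"
proof (induction n)
  case (Suc n)
  then show ?case by (auto simp: power_le_one)
qed simp

lemma sqrt_majorant_Suc: "sqrt_majorant n \<le> sqrt_majorant (Suc n)"
  using zero_le_power2[of "sqrt_majorant n - 1"] by (simp add: power2_eq_square field_simps)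

text \<open>Take \<open>A = I - T\<close>, a contraction by \<open>T\<^sup>2 \<le> T\<close>. The majorant makes the iterates converge
  at every vector; with \<open>L\<close> the limit, the square root is \<open>I - L\<close>, and it is positive
  because \<open>L\<close> is a symmetric contraction.\<close>

lemma sqrt_exists_contraction:
  fixes T :: "'a::chilbert_space \<Rightarrow> 'a"
  assumes pos: "positive_on UNIV T" and contr: "\<And>x. norm (T x) \<le> norm x"
  shows "\<exists>S. positive_on UNIV S \<and> S \<circ> S = T"
proof -
  have T: "T (x + y) = T x + T y" "T (a *\<^sub>C x) = a *\<^sub>C T x" for x y a
    using pos by (auto simp: positive_on_def bounded_between_def clinear_between_def)
  define A where "A = (\<lambda>x. x - T x)"
  define R where "R = sqrt_iter A"
  let ?s = sqrt_majorant
  have A: "A (x + y) = A x + A y" "A (a *\<^sub>C x) = a *\<^sub>C A x" "cinner (A x) y = cinner x (A y)" for x y a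
    using T by (auto simp: A_def scaleC_diff_right cinner.diff_left cinner.diff_right positive_symmetric[OF pos])
  have normA: "norm (A x) \<le> norm x" for x
  proof (rule power2_le_imp_le)
    show "(norm (A x))\<^sup>2 \<le> (norm x)\<^sup>2"
      using positive_norm_square_le[OF pos contr, of x] zero_le_power2[of "norm (T x)"]
      unfolding A_def norm_diff_square Re_cinner_commute[of x] by linarith
  qed simp
  have R0: "R 0 x = 0" and RSuc: "R (Suc n) x = (1/2) *\<^sub>R (A x + R n (R n x))" for n x
    by (auto simp: R_def)
  have Radd: "R n (x + y) = R n x + R n y" for n x y
    by (induction n arbitrary: x y) (auto simp: R0 RSuc A algebra_simps)
  have Rdiff: "R n (x - y) = R n x - R n y" for n x y
    using Radd[of n "x - y" y] by (simp add: algebra_simps)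
  have Rscale: "R n (a *\<^sub>C x) = a *\<^sub>C R n x" for n a x
    by (induction n arbitrary: x)
      (auto simp: R0 RSuc A scaleC_add_right scaleC_scaleC scaleR_scaleC mult.commute)
  have Rsym: "cinner (R n x) y = cinner x (R n y)" for n x y
    by (induction n arbitrary: x y)
      (auto simp: R0 RSuc A cinner.zero_left cinner.zero_right cinner_scaleR_left cinner_scaleR_right
        cinner_add_left cinner_add_right)
  have Rnorm: "norm (R n x) \<le> ?s n * norm x" for n x
  proof (induction n arbitrary: x)
    case (Suc n)
    have "norm (R n (R n x)) \<le> ?s n * (?s n * norm x)"
      using Suc[of "R n x"] mult_left_mono[OF Suc[of x], of "?s n"] sqrt_majorant_bounds[of n] by linarith
    then have "norm (A x + R n (R n x)) \<le> norm x + ?s n * (?s n * norm x)"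
      using normA[of x] norm_triangle_ineq[of "A x" "R n (R n x)"] by linarith
    then show ?case
      by (simp add: RSuc power2_eq_square distrib_right mult.assoc)
  qed (simp add: R0)
  have Rcontr: "norm (R n x) \<le> norm x" for n x
    using Rnorm[of n x] mult_right_mono[of "?s n" 1 "norm x"] sqrt_majorant_bounds[of n] by auto
  have Rstep: "norm (R (Suc n) x - R n x) \<le> (?s (Suc n) - ?s n) * norm x" for n x
  proof (induction n arbitrary: x)
    case 0
    then show ?case using normA[of x] by (simp add: R0 RSuc)
  next
    case (Suc n)
    let ?d = "?s (Suc n) - ?s n"
    have d: "0 \<le> ?d" using sqrt_majorant_Suc[of n] by linarith
    \<comment> \<open>\<open>Q\<^sup>2 - R\<^sup>2 = Q (Q - R) + (Q - R) R\<close> holds without commutativity.\<close>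
    have eq: "R (Suc (Suc n)) x - R (Suc n) x =
        (1/2) *\<^sub>R (R (Suc n) (R (Suc n) x - R n x) + (R (Suc n) (R n x) - R n (R n x)))"
      unfolding RSuc[of "Suc n" x] Rdiff by (simp add: RSuc[of n x] flip: scaleR_diff_right)
    have "norm (R (Suc n) (R (Suc n) x - R n x)) \<le> ?s (Suc n) * (?d * norm x)"
      using Rnorm[of "Suc n" "R (Suc n) x - R n x"] mult_left_mono[OF Suc[of x], of "?s (Suc n)"]
        sqrt_majorant_bounds[of "Suc n"] by linarith
    moreover have "norm (R (Suc n) (R n x) - R n (R n x)) \<le> ?d * (?s n * norm x)"
      using Suc[of "R n x"] mult_left_mono[OF Rnorm[of n x] d] by linarith
    ultimately have "norm (R (Suc (Suc n)) x - R (Suc n) x)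
        \<le> (1/2) * (?s (Suc n) * (?d * norm x) + ?d * (?s n * norm x))"
      unfolding eq
      using norm_triangle_ineq[of "R (Suc n) (R (Suc n) x - R n x)" "R (Suc n) (R n x) - R n (R n x)"]
      by simp
    also have "\<dots> = (?s (Suc (Suc n)) - ?s (Suc n)) * norm x"
    proof -
      have "?s (Suc (Suc n)) - ?s (Suc n) = ((?s (Suc n))\<^sup>2 - (?s n)\<^sup>2) / 2"
        by (subst (1 2) sqrt_majorant.simps(2)) (simp only: diff_divide_distrib add_divide_distrib)
      also have "(?s (Suc n))\<^sup>2 - (?s n)\<^sup>2 = (?s (Suc n) + ?s n) * ?d"
        by (simp only: power2_eq_square square_diff_square_factored)
      finally have step: "?s (Suc (Suc n)) - ?s (Suc n) = (?s (Suc n) + ?s n) * ?d / 2" .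
      show ?thesis
        unfolding step by (simp add: field_simps del: sqrt_majorant.simps)
    qed
    finally show ?case .
  qed
  have summ: "summable (\<lambda>n. ?s (Suc n) - ?s n)"
  proof -
    have "convergent ?s"
      by (rule Bseq_monoseq_convergent[OF BseqI'[of _ 1]])
        (use sqrt_majorant_bounds sqrt_majorant_Suc in \<open>auto simp: monoseq_Suc\<close>)
    then show ?thesis
      using telescope_summable unfolding convergent_def by blast
  qed
  have conv: "convergent (\<lambda>n. R n x)" for x
  proof -
    have "summable (\<lambda>n. R (Suc n) x - R n x)"
      by (rule summable_comparison_test[OF _ summable_mult2[OF summ, of "norm x"]])
        (use Rstep in blast)
    then have "convergent (\<lambda>n. \<Sum>k<n. R (Suc k) x - R k x)"
      by (simp add: summable_iff_convergent)
    then show ?thesis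
      by (simp only: sum_lessThan_telescope[of "\<lambda>k. R k x"] R0 diff_zero)
  qed
  define L where "L x = lim (\<lambda>n. R n x)" for x
  have lim: "(\<lambda>n. R n x) \<longlonglongrightarrow> L x" for x
    using conv[of x] by (simp add: L_def convergent_LIMSEQ_iff)
  have Ladd: "L (x + y) = L x + L y" for x y
    using LIMSEQ_unique[OF lim[of "x + y"]] tendsto_add[OF lim[of x] lim[of y]] by (simp add: Radd)
  have Lscale: "L (a *\<^sub>C x) = a *\<^sub>C L x" for a x
    using LIMSEQ_unique[OF lim[of "a *\<^sub>C x"]] bounded_linear.tendsto[OF bounded_linear_scaleC lim[of x], of a]
    by (simp add: Rscale)
  have Lsym: "cinner (L x) y = cinner x (L y)" for x y
    using LIMSEQ_unique[OF cinner.tendsto[OF lim[of x] tendsto_const[of y]]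
        cinner.tendsto[OF tendsto_const[of x] lim[of y], folded Rsym]] .
  have Lcontr: "norm (L x) \<le> norm x" for x
    using lim[of x] Rcontr by (intro LIMSEQ_le_const2[OF tendsto_norm[OF lim[of x]]]) auto
  have RR: "(\<lambda>n. R n (R n x)) \<longlonglongrightarrow> L (L x)" for x
  proof -
    have "(\<lambda>n. R n (R n x - L x)) \<longlonglongrightarrow> 0"
    proof (rule Lim_null_comparison)
      show "\<forall>\<^sub>F n in sequentially. norm (R n (R n x - L x)) \<le> norm (R n x - L x)"
        using Rcontr by auto
      show "(\<lambda>n. norm (R n x - L x)) \<longlonglongrightarrow> 0"
        using lim[of x] by (simp add: LIM_zero tendsto_norm_zero)
    qed
    from tendsto_add[OF this lim[of "L x"]] show ?thesis
      by (simp add: Rdiff)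
  qed
  have fix_eq: "L x = (1/2) *\<^sub>R (A x + L (L x))" for x
  proof (rule LIMSEQ_unique)
    show "(\<lambda>n. R (Suc n) x) \<longlonglongrightarrow> L x" using lim[of x] by (rule LIMSEQ_Suc)
    show "(\<lambda>n. R (Suc n) x) \<longlonglongrightarrow> (1/2) *\<^sub>R (A x + L (L x))"
      unfolding RSuc by (intro tendsto_intros RR)
  qed
  define S where "S = (\<lambda>x. x - L x)"
  have Ldiff: "L (x - y) = L x - L y" for x y
    using Ladd[of "x - y" y] by (simp add: algebra_simps)
  have "S (S x) = T x" for x
  proof -
    have "S (S x) = x - 2 *\<^sub>R L x + L (L x)"
      by (simp add: S_def Ldiff scaleR_2)
    also have "2 *\<^sub>R L x = A x + L (L x)"
      by (subst fix_eq) simp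
    finally show ?thesis by (simp add: A_def)
  qed
  moreover have "positive_on UNIV S"
  proof -
    have "clinear_between UNIV UNIV S"
      by (auto simp: clinear_between_def S_def Ladd Lscale scaleC_diff_right)
    moreover have "norm (S x) \<le> 2 * norm x" for x
      using norm_triangle_ineq4[of x "L x"] Lcontr[of x] by (simp add: S_def)
    moreover have "cinner (S x) x \<in> \<real>\<^sub>\<ge>\<^sub>0" for x
    proof -
      have "cnj (cinner (L x) x) = cinner (L x) x"
        by (simp add: cnj_cinner Lsym)
      then have "Im (cinner (L x) x) = 0"
        by (simp add: complex_eq_iff)
      moreover have "Re (cinner (L x) x) \<le> (norm x)\<^sup>2"
        using complex_Re_le_cmod[of "cinner (L x) x"] cauchy_schwarz[of "L x" x]
          mult_right_mono[OF Lcontr[of x], of "norm x"] by (simp add: power2_eq_square)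
      ultimately show ?thesis
        by (simp add: S_def complex_nonneg_Reals_iff cinner.diff_left cinner_self)
    qed
    ultimately show ?thesis
      by (auto simp: positive_on_def bounded_between_def)
  qed
  ultimately show ?thesis
    by (auto simp: fun_eq_iff)
qed

lemma sqrt_exists:
  fixes T :: "'a::chilbert_space \<Rightarrow> 'a"
  assumes pos: "positive_on UNIV T"
  shows "\<exists>S. positive_on UNIV S \<and> S \<circ> S = T"
proof -
  obtain K where K: "\<And>x. norm (T x) \<le> K * norm x"
    using pos by (auto simp: positive_on_def bounded_between_def)
  define c where "c = \<bar>K\<bar> + 1"
  have c: "c > 0" and Kc: "K \<le> c" by (auto simp: c_def)
  have scale: "positive_on UNIV (\<lambda>x. r *\<^sub>R S x)" if "positive_on UNIV S" "r \<ge> 0"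
    for r and S :: "'a \<Rightarrow> 'a"
  proof -
    from that(1) obtain M where M: "\<And>x. norm (S x) \<le> M * norm x"
      by (auto simp: positive_on_def bounded_between_def)
    have "norm (r *\<^sub>R S x) \<le> (r * M) * norm x" for x
      using mult_left_mono[OF M[of x] that(2)] that(2) by (simp add: mult.assoc)
    then show ?thesis
      using that unfolding positive_on_def bounded_between_def clinear_between_def
      by (auto simp: cinner_scaleC_left complex_nonneg_Reals_iff scaleC_add_right
          scaleR_scaleC scaleC_scaleC mult.commute intro!: exI[of _ "r * M"])
  qed
  have "norm ((1/c) *\<^sub>R T x) \<le> norm x" for x
    using K[of x] mult_right_mono[OF Kc, of "norm x"] c by (simp add: divide_le_eq mult.commute)
  then obtain S where S: "positive_on UNIV S" "S \<circ> S = (\<lambda>x. (1/c) *\<^sub>R T x)"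
    using sqrt_exists_contraction[OF scale[OF pos, of "1/c"]] c by auto
  have Sscale: "S (r *\<^sub>R x) = r *\<^sub>R S x" for r x
    using S(1) by (auto simp: positive_on_def bounded_between_def clinear_between_def scaleR_scaleC)
  have "sqrt c *\<^sub>R S (sqrt c *\<^sub>R S x) = T x" for x
    using fun_cong[OF S(2), of x] c by (simp add: Sscale)
  then show ?thesis
    using scale[OF S(1), of "sqrt c"] c by (intro exI[of _ "\<lambda>x. sqrt c *\<^sub>R S x"]) (auto simp: fun_eq_iff)
qed

section \<open>Bounded operators on closed subspaces and their adjoints\<close>

text \<open>A closed complex linear subspace, given by its carrier.\<close>

definition closed_csubspace :: "'a::chilbert_space set \<Rightarrow> bool" where
  "closed_csubspace U \<longleftrightarrow> closed U \<and> 0 \<in> U \<and> (\<forall>x\<in>U. \<forall>y\<in>U. x + y \<in> U) \<and> (\<forall>a. \<forall>x\<in>U. a *\<^sub>C x \<in> U)"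

lemma closed_csubspaceD:
  assumes "closed_csubspace U"
  shows "closed U" "0 \<in> U" "\<And>x y. x \<in> U \<Longrightarrow> y \<in> U \<Longrightarrow> x + y \<in> U"
    "\<And>a x. x \<in> U \<Longrightarrow> a *\<^sub>C x \<in> U" "\<And>r x. x \<in> U \<Longrightarrow> r *\<^sub>R x \<in> U"
    "\<And>x y. x \<in> U \<Longrightarrow> y \<in> U \<Longrightarrow> x - y \<in> U"
proof -
  have add: "x + y \<in> U" and scale: "a *\<^sub>C x \<in> U" if "x \<in> U" "y \<in> U" for x y a
    using assms that by (auto simp: closed_csubspace_def)
  show "x - y \<in> U" if "x \<in> U" "y \<in> U" for x y
    using add[OF that(1) scale[OF that(2,2), of "-1"]] by (simp add: scaleC_minus_one)
qed (use assms in \<open>auto simp: closed_csubspace_def scaleR_scaleC\<close>)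

lemma clinear_betweenD:
  assumes "clinear_between U V T"
  shows "\<And>x. x \<in> U \<Longrightarrow> T x \<in> V" "\<And>x y. x \<in> U \<Longrightarrow> y \<in> U \<Longrightarrow> T (x + y) = T x + T y"
    "\<And>x a. x \<in> U \<Longrightarrow> T (a *\<^sub>C x) = a *\<^sub>C T x"
  using assms by (auto simp: clinear_between_def)

lemma clinear_between_diff:
  assumes "closed_csubspace U" "clinear_between U V T" "x \<in> U" "y \<in> U"
  shows "T (x - y) = T x - T y"
  using clinear_betweenD(2)[OF assms(2), of "x - y" y] closed_csubspaceD(6)[OF assms(1)] assms(3,4)
  by (simp add: algebra_simps)

lemma bounded_betweenE:
  assumes "bounded_between U V T"
  obtains K where "K \<ge> 0" "\<And>x. x \<in> U \<Longrightarrow> norm (T x) \<le> K * norm x"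
proof -
  obtain K where K: "\<And>x. x \<in> U \<Longrightarrow> norm (T x) \<le> K * norm x"
    using assms by (auto simp: bounded_between_def)
  have "norm (T x) \<le> \<bar>K\<bar> * norm x" if "x \<in> U" for x
    using K[OF that] mult_right_mono[OF abs_ge_self norm_ge_zero, of K x] by linarith
  then show thesis using that[of "\<bar>K\<bar>"] by auto
qed

lemma bounded_between_compose:
  assumes "bounded_between U V T" "bounded_between V W S"
  shows "bounded_between U W (\<lambda>x. S (T x))"
proof -
  obtain K where K: "K \<ge> 0" "\<And>x. x \<in> U \<Longrightarrow> norm (T x) \<le> K * norm x"
    using bounded_betweenE[OF assms(1)] by blast
  obtain L where L: "L \<ge> 0" "\<And>x. x \<in> V \<Longrightarrow> norm (S x) \<le> L * norm x"
    using bounded_betweenE[OF assms(2)] by blast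
  have lin: "clinear_between U V T" "clinear_between V W S"
    using assms by (auto simp: bounded_between_def)
  have "norm (S (T x)) \<le> (L * K) * norm x" if "x \<in> U" for x
    using L(2)[OF clinear_betweenD(1)[OF lin(1) that]] mult_left_mono[OF K(2)[OF that] L(1)]
    by (simp add: mult.assoc)
  then show ?thesis
    using lin unfolding bounded_between_def clinear_between_def by auto
qed

lemma bounded_between_diff:
  assumes "closed_csubspace V" "bounded_between U V T" "bounded_between U V S"
  shows "bounded_between U V (\<lambda>x. T x - S x)"
proof -
  obtain K where K: "\<And>x. x \<in> U \<Longrightarrow> norm (T x) \<le> K * norm x"
    using bounded_betweenE[OF assms(2)] by blast
  obtain L where L: "\<And>x. x \<in> U \<Longrightarrow> norm (S x) \<le> L * norm x"
    using bounded_betweenE[OF assms(3)] by blast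
  have "norm (T x - S x) \<le> (K + L) * norm x" if "x \<in> U" for x
    using K[OF that] L[OF that] norm_triangle_ineq4[of "T x" "S x"] by (simp add: distrib_right)
  moreover have "clinear_between U V (\<lambda>x. T x - S x)"
    using assms closed_csubspaceD(6)[OF assms(1)]
    by (auto simp: bounded_between_def clinear_between_def scaleC_diff_right)
  ultimately show ?thesis
    by (auto simp: bounded_between_def)
qed

lemma bounded_between_sum:
  fixes T :: "nat \<Rightarrow> 'a::chilbert_space \<Rightarrow> 'b::chilbert_space"
  assumes V: "closed_csubspace V" and "\<And>j. j < m \<Longrightarrow> bounded_between U V (T j)"
  shows "bounded_between U V (\<lambda>x. \<Sum>j<m. T j x)"
  using assms(2)
proof (induction m)
  case 0
  then show ?case
    using closed_csubspaceD(2)[OF V]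
    by (auto simp: bounded_between_def clinear_between_def intro!: exI[of _ 0])
next
  case (Suc m)
  have IH: "bounded_between U V (\<lambda>x. \<Sum>j<m. T j x)"
    using Suc by simp
  obtain K where K: "\<And>x. x \<in> U \<Longrightarrow> norm (\<Sum>j<m. T j x) \<le> K * norm x"
    using bounded_betweenE[OF IH] by blast
  obtain L where L: "\<And>x. x \<in> U \<Longrightarrow> norm (T m x) \<le> L * norm x"
    using bounded_betweenE[OF Suc.prems[of m]] by blast
  have "norm ((\<Sum>j<m. T j x) + T m x) \<le> (K + L) * norm x" if "x \<in> U" for x
    using K[OF that] L[OF that] norm_triangle_ineq[of "\<Sum>j<m. T j x" "T m x"]
    by (simp add: distrib_right)
  moreover have "clinear_between U V (\<lambda>x. (\<Sum>j<m. T j x) + T m x)"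
    using IH Suc.prems[of m] closed_csubspaceD(3)[OF V]
    by (auto simp: bounded_between_def clinear_between_def scaleC_add_right algebra_simps)
  ultimately show ?case
    by (auto simp: bounded_between_def)
qed

lemma contraction_between_imp_bounded:
  "contraction_between U V T \<Longrightarrow> bounded_between U V T"
  by (auto simp: contraction_between_def bounded_between_def intro!: exI[of _ 1])

lemma bounded_between_continuous_on:
  assumes "closed_csubspace U" "bounded_between U V T"
  shows "continuous_on U T"
proof -
  obtain K where K: "K \<ge> 0" "\<And>x. x \<in> U \<Longrightarrow> norm (T x) \<le> K * norm x"
    using bounded_betweenE[OF assms(2)] by blast
  have "K-lipschitz_on U T"
  proof (rule lipschitz_onI)
    show "dist (T x) (T y) \<le> K * dist x y" if "x \<in> U" "y \<in> U" for x y
      using K(2)[OF closed_csubspaceD(6)[OF assms(1) that]] assms(2)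
        clinear_between_diff[OF assms(1) _ that, of V T]
      by (simp add: dist_norm bounded_between_def)
  qed (rule K(1))
  then show ?thesis
    by (rule lipschitz_on_continuous_on)
qed

lemma linear_term_zero:
  fixes b c :: real
  assumes "c \<ge> 0" "\<And>t. 0 \<le> 2 * t * b + t\<^sup>2 * c"
  shows "b = 0"
proof (rule ccontr)
  assume "b \<noteq> 0"
  have "2 * (- b / (c + 1)) * b + (- b / (c + 1))\<^sup>2 * c = - (b\<^sup>2 * (c + 2)) / (c + 1)\<^sup>2"
    using assms(1) by (simp add: divide_simps) (simp add: power2_eq_square algebra_simps)
  also have "\<dots> < 0"
    using \<open>b \<noteq> 0\<close> assms(1) by (simp add: divide_less_0_iff)
  finally show False
    using assms(2)[of "- b / (c + 1)"] by linarith
qed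

text \<open>The representing vector minimizes \<open>\<parallel>x\<parallel>\<^sup>2 - 2 Re (f x)\<close> over \<open>U\<close>. A minimizing
  sequence is Cauchy by the parallelogram law.\<close>

theorem riesz_representation:
  fixes U :: "'a::chilbert_space set" and f :: "'a \<Rightarrow> complex"
  assumes U: "closed_csubspace U"
    and add: "\<And>x y. x \<in> U \<Longrightarrow> y \<in> U \<Longrightarrow> f (x + y) = f x + f y"
    and scale: "\<And>a x. x \<in> U \<Longrightarrow> f (a *\<^sub>C x) = a * f x"
    and bound: "\<And>x. x \<in> U \<Longrightarrow> cmod (f x) \<le> K * norm x"
  shows "\<exists>z\<in>U. \<forall>x\<in>U. f x = cinner x z"
proof -
  note UD = closed_csubspaceD[OF U]
  have scaleR: "f (r *\<^sub>R x) = r *\<^sub>R f x" if "x \<in> U" for r x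
    using that by (simp add: scaleR_scaleC scale scaleR_conv_of_real)
  define g where "g x = (norm x)\<^sup>2 - 2 * Re (f x)" for x
  have g_lower: "- K\<^sup>2 \<le> g x" if "x \<in> U" for x
    using complex_Re_le_cmod[of "f x"] bound[OF that] zero_le_power2[of "norm x - K"]
    by (simp add: g_def power2_eq_square algebra_simps)
  define d where "d = Inf (g ` U)"
  have bdd: "bdd_below (g ` U)"
    using g_lower by (auto intro!: bdd_belowI[of _ "- K\<^sup>2"])
  have d_le: "d \<le> g x" if "x \<in> U" for x
    unfolding d_def using bdd that by (auto intro: cInf_lower)
  have "\<exists>x\<in>U. g x < d + 1 / Suc n" for n
  proof -
    have "Inf (g ` U) < d + 1 / Suc n" by (simp add: d_def)
    then show ?thesis
      using cInf_less_iff[OF _ bdd] UD(2) by blast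
  qed
  then obtain u where u: "\<And>n. u n \<in> U" "\<And>n. g (u n) < d + 1 / Suc n"
    by metis
  have mid: "(norm (x - y))\<^sup>2 \<le> 2 * g x + 2 * g y - 4 * d" if "x \<in> U" "y \<in> U" for x y
  proof -
    have "(norm (x + y))\<^sup>2 + (norm (x - y))\<^sup>2 = 2 * (norm x)\<^sup>2 + 2 * (norm y)\<^sup>2"
      by (simp add: norm_add_square norm_diff_square)
    moreover have "g ((1/2) *\<^sub>R (x + y)) = (norm (x + y))\<^sup>2 / 4 - Re (f x + f y)"
      using that UD(3) by (simp add: g_def scaleR add power_divide add_divide_distrib)
    ultimately show ?thesis
      using d_le[OF UD(5)[OF UD(3)[OF that]], of "1/2"] by (simp add: g_def)
  qed
  have "Cauchy u"
  proof (rule CauchyI)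
    fix e :: real assume "e > 0"
    then obtain N where N: "1 / Suc N < e\<^sup>2 / 4"
      using nat_approx_posE[of "e\<^sup>2 / 4"] by auto
    have "norm (u p - u q) < e" if "p \<ge> N" "q \<ge> N" for p q
    proof -
      have small: "1 / Suc k \<le> 1 / Suc N" if "k \<ge> N" for k
        using that by (simp add: frac_le)
      have "(norm (u p - u q))\<^sup>2 < e\<^sup>2"
        using mid[OF u(1) u(1), of p q] u(2)[of p] u(2)[of q] N small[OF that(1)] small[OF that(2)]
        by linarith
      then show ?thesis
        using \<open>e > 0\<close> by (simp add: power2_less_imp_less)
    qed
    then show "\<exists>N. \<forall>p\<ge>N. \<forall>q\<ge>N. norm (u p - u q) < e" by blast
  qed
  then obtain z where z: "u \<longlonglongrightarrow> z"
    by (auto simp: Cauchy_convergent_iff convergent_def)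
  have zU: "z \<in> U"
    using closed_sequentially[OF UD(1)] u(1) z by blast
  have "(\<lambda>n. g (u n)) \<longlonglongrightarrow> g z"
  proof -
    have "(\<lambda>n. f (u n) - f z) \<longlonglongrightarrow> 0"
    proof (rule Lim_null_comparison)
      have fd: "f (u n) - f z = f (u n - z)" for n
        using add[of "u n - z" z] UD(6)[OF u(1) zU] zU by simp
      show "\<forall>\<^sub>F n in sequentially. cmod (f (u n) - f z) \<le> K * norm (u n - z)"
        unfolding fd using bound UD(6)[OF u(1) zU] by simp
      show "(\<lambda>n. K * norm (u n - z)) \<longlonglongrightarrow> 0"
        using z by (auto intro!: tendsto_mult_right_zero tendsto_norm_zero LIM_zero)
    qed
    then have "(\<lambda>n. f (u n)) \<longlonglongrightarrow> f z" by (rule LIM_zero_cancel)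
    then show ?thesis
      unfolding g_def by (intro tendsto_intros z)
  qed
  moreover have "(\<lambda>n. d + 1 / Suc n) \<longlonglongrightarrow> d"
    using tendsto_add[OF tendsto_const[of d] LIMSEQ_inverse_real_of_nat]
    by (simp add: inverse_eq_divide)
  ultimately have "g z \<le> d"
    by (rule LIMSEQ_le) (use u(2) less_imp_le in blast)
  then have min: "g z \<le> g x" if "x \<in> U" for x
    using d_le[OF that] by linarith
  \<comment> \<open>The first variation of \<open>g\<close> at its minimum vanishes.\<close>
  have Re_eq: "Re (f x) = Re (cinner x z)" if "x \<in> U" for x
  proof -
    have "Re (cinner x z) - Re (f x) = 0"
    proof (rule linear_term_zero[of "(norm x)\<^sup>2"])
      fix t :: real
      have "g (z + t *\<^sub>R x) = g z + 2 * t * (Re (cinner x z) - Re (f x)) + t\<^sup>2 * (norm x)\<^sup>2"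
        using that zU UD(5)
        by (simp add: g_def add scaleR norm_add_square cinner_scaleR_right
            Re_cinner_commute[of z] power_mult_distrib algebra_simps)
      then show "0 \<le> 2 * t * (Re (cinner x z) - Re (f x)) + t\<^sup>2 * (norm x)\<^sup>2"
        using min[OF UD(3)[OF zU UD(5)[OF that]], of t] by simp
    qed simp
    then show ?thesis by simp
  qed
  \<comment> \<open>The real parts at \<open>\<i> *\<^sub>C x\<close> give the imaginary parts at \<open>x\<close>.\<close>
  have "f x = cinner x z" if "x \<in> U" for x
    using Re_eq[OF that] Re_eq[OF UD(4)[OF that], of \<i>] that
    by (simp add: complex_eq_iff scale cinner_scaleC_left)
  then show ?thesis
    using zU by blast
qed

lemma cinner_determines:
  assumes "closed_csubspace U" "z \<in> U" "z' \<in> U" "\<And>x. x \<in> U \<Longrightarrow> cinner x z = cinner x z'"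
  shows "z = z'"
proof -
  have "cinner (z - z') (z - z') = 0"
    using assms(4)[OF closed_csubspaceD(6)[OF assms(1-3)]] by (simp add: cinner.diff_right)
  then show ?thesis by (simp add: cinner_self)
qed

text \<open>The form \<open>ip\<close> on the target is arbitrary, so that the lemma also applies to maps into
  direct sums.\<close>

lemma hadjoint_eqI:
  assumes "closed_csubspace U" "z \<in> U" "\<And>x. x \<in> U \<Longrightarrow> ip (T x) y = cinner x z"
  shows "hadjoint U cinner ip T y = z"
  unfolding hadjoint_def
  by (rule the_equality) (use assms cinner_determines[OF assms(1)] in auto)

lemma hadjoint_works:
  fixes U :: "'a::chilbert_space set" and T :: "'a \<Rightarrow> 'b::chilbert_space"
  assumes U: "closed_csubspace U" and T: "bounded_between U V T"
  shows "hadjoint U cinner cinner T y \<in> U"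
    and "x \<in> U \<Longrightarrow> cinner (T x) y = cinner x (hadjoint U cinner cinner T y)"
proof -
  obtain K where K: "\<And>x. x \<in> U \<Longrightarrow> norm (T x) \<le> K * norm x"
    using bounded_betweenE[OF T] by blast
  have lin: "clinear_between U V T"
    using T by (simp add: bounded_between_def)
  obtain z where z: "z \<in> U" "\<And>x. x \<in> U \<Longrightarrow> cinner (T x) y = cinner x z"
  proof (atomize_elim, rule riesz_representation[OF U, simplified Bex_def Ball_def])
    show "cmod (cinner (T x) y) \<le> (K * norm y) * norm x" if "x \<in> U" for x
      using cauchy_schwarz[of "T x" y] mult_right_mono[OF K[OF that], of "norm y"]
      by (simp add: mult_ac)
  qed (use clinear_betweenD[OF lin] in \<open>simp_all add: cinner_add_left cinner_scaleC_left\<close>)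
  moreover from this have "hadjoint U cinner cinner T y = z"
    by (intro hadjoint_eqI[OF U])
  ultimately show "hadjoint U cinner cinner T y \<in> U"
    and "x \<in> U \<Longrightarrow> cinner (T x) y = cinner x (hadjoint U cinner cinner T y)"
    by auto
qed

lemma hadjoint_bounded:
  fixes U :: "'a::chilbert_space set" and T :: "'a \<Rightarrow> 'b::chilbert_space"
  assumes U: "closed_csubspace U" and T: "bounded_between U V T"
  shows "bounded_between V' U (hadjoint U cinner cinner T)"
proof -
  let ?A = "hadjoint U cinner cinner T"
  note A = hadjoint_works[OF U T]
  note UD = closed_csubspaceD[OF U]
  obtain K where K: "K \<ge> 0" "\<And>x. x \<in> U \<Longrightarrow> norm (T x) \<le> K * norm x"
    using bounded_betweenE[OF T] by blast
  have "?A (x + y) = ?A x + ?A y" for x y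
    by (rule hadjoint_eqI[OF U]) (use A UD in \<open>auto simp: cinner_add_right\<close>)
  moreover have "?A (a *\<^sub>C x) = a *\<^sub>C ?A x" for a x
    by (rule hadjoint_eqI[OF U]) (use A UD in \<open>auto simp: cinner_scaleC_right\<close>)
  moreover have "norm (?A y) \<le> K * norm y" for y
  proof (cases "?A y = 0")
    case False
    have "(norm (?A y))\<^sup>2 = Re (cinner (T (?A y)) y)"
      using A by (simp add: Re_cinner_self)
    also have "\<dots> \<le> norm (T (?A y)) * norm y"
      using cauchy_schwarz complex_Re_le_cmod order_trans by blast
    also have "\<dots> \<le> K * norm (?A y) * norm y"
      by (rule mult_right_mono[OF K(2)[OF A(1)]]) simp
    finally show ?thesis
      using False by (simp add: power2_eq_square mult_ac)
  qed (use K in simp)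
  ultimately show ?thesis
    using A(1) unfolding bounded_between_def clinear_between_def by blast
qed

lemma selfadjoint_on_symmetric:
  assumes "closed_csubspace U" "selfadjoint_on U T" "x \<in> U" "y \<in> U"
  shows "cinner (T x) y = cinner x (T y)"
  using hadjoint_works(2)[OF assms(1) _ assms(3), of U T y] assms(2,4)
  by (simp add: selfadjoint_on_def)

section \<open>Contractions determined on a dense range\<close>

lemma closed_csubspace_closure_range:
  fixes S :: "'a::chilbert_space \<Rightarrow> 'b::chilbert_space"
  assumes "clinear_between UNIV UNIV S"
  shows "closed_csubspace (closure (range S))"
proof -
  note SD = clinear_betweenD[OF assms, simplified]
  have "x + y \<in> closure (range S)" if "x \<in> closure (range S)" "y \<in> closure (range S)" for x y
  proof -
    obtain u v where u: "\<And>n. u n \<in> range S" "u \<longlonglongrightarrow> x" and v: "\<And>n. v n \<in> range S" "v \<longlonglongrightarrow> y"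
      using \<open>x \<in> _\<close> \<open>y \<in> _\<close> unfolding closure_sequential by blast
    have "u n + v n \<in> range S" for n
      using u(1)[of n] v(1)[of n] by (auto simp flip: SD(2))
    then show ?thesis
      using tendsto_add[OF u(2) v(2)] unfolding closure_sequential
      by (intro exI[of _ "\<lambda>n. u n + v n"] conjI allI)
  qed
  moreover have "a *\<^sub>C x \<in> closure (range S)" if x: "x \<in> closure (range S)" for a x
  proof -
    obtain u where u: "\<And>n. u n \<in> range S" "u \<longlonglongrightarrow> x"
      using x unfolding closure_sequential by blast
    have "a *\<^sub>C u n \<in> range S" for n
      using u(1)[of n] by (auto simp flip: SD(3))
    then show ?thesis
      using bounded_linear.tendsto[OF bounded_linear_scaleC u(2), of a]
      unfolding closure_sequential by (intro exI[of _ "\<lambda>n. a *\<^sub>C u n"] conjI allI)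
  qed
  moreover have "0 \<in> range S"
    using SD(3)[of 0 0] by (intro range_eqI[of _ _ 0]) simp
  ultimately show ?thesis
    using closure_subset[of "range S"] by (auto simp: closed_csubspace_def)
qed

lemma contraction_between_unique:
  assumes "closed_csubspace (closure (range S))"
    and "contraction_between (closure (range S)) V C" "contraction_between (closure (range S)) V C'"
    and "\<And>h. C (S h) = C' (S h)" and "x \<in> closure (range S)"
  shows "C x = C' x"
proof -
  obtain u where u: "\<And>n. u n \<in> range S" "u \<longlonglongrightarrow> x"
    using assms(5) unfolding closure_sequential by blast
  have u': "u n \<in> closure (range S)" for n
    using u(1) closure_subset by blast
  have conv: "(\<lambda>n. D (u n)) \<longlonglongrightarrow> D x" if "contraction_between (closure (range S)) V D" for D
    using continuous_on_tendsto_compose[OF bounded_between_continuous_on[OF assms(1)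
          contraction_between_imp_bounded[OF that]] u(2) assms(5)] u' by simp
  have "C (u n) = C' (u n)" for n
    using u(1)[of n] assms(4) by auto
  then show ?thesis
    using LIMSEQ_unique[OF conv[OF assms(2)]] conv[OF assms(3)] by simp
qed

text \<open>\<open>S h \<mapsto> T h\<close> is well defined and nonexpansive on the range of \<open>S\<close>, and its continuous
  extension to the closure inherits linearity.\<close>

lemma contraction_extension:
  fixes S :: "'a::chilbert_space \<Rightarrow> 'b::chilbert_space" and T :: "'a \<Rightarrow> 'c::chilbert_space"
  assumes S: "clinear_between UNIV UNIV S" and T: "clinear_between UNIV UNIV T"
    and le: "\<And>h. norm (T h) \<le> norm (S h)"
  shows "\<exists>C. contraction_between (closure (range S)) (closure (range T)) C \<and> (\<forall>h. C (S h) = T h)"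
proof -
  note SD = clinear_betweenD[OF S, simplified] and TD = clinear_betweenD[OF T, simplified]
  have Sdiff: "S (x - y) = S x - S y" and Tdiff: "T (x - y) = T x - T y" for x y
    using SD(2)[of "x - y" y] TD(2)[of "x - y" y] by (auto simp: algebra_simps)
  define f where "f y = T (SOME h. S h = y)" for y
  have f: "f (S h) = T h" for h
  proof -
    have "S (SOME h'. S h' = S h) = S h" by (rule someI) simp
    then show ?thesis
      using le[of "(SOME h'. S h' = S h) - h"] by (simp add: f_def Sdiff Tdiff)
  qed
  have "dist (f (S h)) (f (S k)) \<le> dist (S h) (S k)" for h k
    using le[of "h - k"] by (simp add: f dist_norm Sdiff Tdiff)
  then have "1-lipschitz_on (range S) f"
    by (intro lipschitz_onI) auto
  then have "uniformly_continuous_on (range S) f"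
    by (rule lipschitz_on_uniformly_continuous)
  then obtain C where C: "uniformly_continuous_on (closure (range S)) C"
    and Cf: "\<And>x. x \<in> range S \<Longrightarrow> f x = C x"
    by (rule uniformly_continuous_on_extension_on_closure) blast
  have CS: "C (S h) = T h" for h
    using Cf[of "S h"] by (simp add: f)
  have approx: "\<exists>h. (\<lambda>n. S (h n)) \<longlonglongrightarrow> x \<and> (\<lambda>n. T (h n)) \<longlonglongrightarrow> C x" if x: "x \<in> closure (range S)" for x
  proof -
    obtain u where u: "\<And>n. u n \<in> range S" "u \<longlonglongrightarrow> x"
      using x unfolding closure_sequential by blast
    then have "\<forall>n. \<exists>k. u n = S k"
      by blast
    then obtain h where h: "\<And>n. u n = S (h n)"
      by (auto dest: choice)
    have "(\<lambda>n. C (u n)) \<longlonglongrightarrow> C x"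
      by (rule continuous_on_tendsto_compose[OF uniformly_continuous_imp_continuous[OF C] u(2) x])
        (intro always_eventually allI subsetD[OF closure_subset u(1)])
    then show ?thesis
      using u(2) by (intro exI[of _ h]) (simp add: h[abs_def] CS)
  qed
  have unique: "C x = l" if "(\<lambda>n. S (h n)) \<longlonglongrightarrow> x" "(\<lambda>n. T (h n)) \<longlonglongrightarrow> l" for h x l
  proof -
    have "x \<in> closure (range S)"
      using that(1) unfolding closure_sequential by (intro exI[of _ "\<lambda>n. S (h n)"]) simp
    then have "(\<lambda>n. C (S (h n))) \<longlonglongrightarrow> C x"
      by (rule continuous_on_tendsto_compose[OF uniformly_continuous_imp_continuous[OF C] that(1)])
        (intro always_eventually allI subsetD[OF closure_subset rangeI])
    then show ?thesis
      using that(2) LIMSEQ_unique by (simp add: CS) 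
  qed
  have "contraction_between (closure (range S)) (closure (range T)) C"
    unfolding contraction_between_def clinear_between_def
  proof (intro conjI ballI allI)
    fix x assume x: "x \<in> closure (range S)"
    obtain h where h: "(\<lambda>n. S (h n)) \<longlonglongrightarrow> x" "(\<lambda>n. T (h n)) \<longlonglongrightarrow> C x"
      using approx[OF x] by blast
    show "C x \<in> closure (range T)"
      using h(2) unfolding closure_sequential by (intro exI[of _ "\<lambda>n. T (h n)"]) simp
    show "norm (C x) \<le> norm x"
      by (rule LIMSEQ_le[OF tendsto_norm[OF h(2)] tendsto_norm[OF h(1)]]) (use le in auto)
    show "C (a *\<^sub>C x) = a *\<^sub>C C x" for a
      by (rule unique[of "\<lambda>n. a *\<^sub>C h n"])
        (use h bounded_linear.tendsto[OF bounded_linear_scaleC] in \<open>auto simp: SD TD\<close>)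
    fix y assume y: "y \<in> closure (range S)"
    obtain k where k: "(\<lambda>n. S (k n)) \<longlonglongrightarrow> y" "(\<lambda>n. T (k n)) \<longlonglongrightarrow> C y"
      using approx[OF y] by blast
    show "C (x + y) = C x + C y"
      by (rule unique[of "\<lambda>n. h n + k n"]) (auto simp: SD TD intro!: tendsto_add h k)
  qed
  then show ?thesis
    using CS by blast
qed

section \<open>The measure of cylinders\<close>

lemma space_Omega: "space (Omega m) = {x. \<forall>i. x i < m}"
  by (auto simp: Omega_def space_PiM PiE_def Pi_def)

lemma cylinder_in_sets: "cylinder m w \<in> sets (Omega m)"
proof -
  have coord: "{x \<in> space (Omega m). x i = w ! i} \<in> sets (Omega m)" for i
  proof -
    have "(\<lambda>x. x i) \<in> measurable (Omega m) (count_space {..<m})"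
      unfolding Omega_def by (rule measurable_component_singleton[OF UNIV_I])
    then have "(\<lambda>x. x i) -` ({..<m} \<inter> {w ! i}) \<inter> space (Omega m) \<in> sets (Omega m)"
      by (rule measurable_sets) simp
    also have "(\<lambda>x. x i) -` ({..<m} \<inter> {w ! i}) \<inter> space (Omega m) =
        {x \<in> space (Omega m). x i = w ! i}"
      unfolding space_Omega by blast
    finally show ?thesis .
  qed
  have "{x \<in> space (Omega m). \<forall>i\<in>{..<length w}. x i = w ! i} \<in> sets (Omega m)"
    by (rule sets.sets_Collect_finite_All[OF coord finite_lessThan])
  also have "{x \<in> space (Omega m). \<forall>i\<in>{..<length w}. x i = w ! i} = cylinder m w"
    unfolding cylinder_def by blast
  finally show ?thesis .
qed

lemma cylinder_append:
  "cylinder m (w @ [j]) = {x \<in> cylinder m w. x (length w) = j}"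
  by (auto simp: cylinder_def nth_append less_Suc_eq)

lemma append_in_words: "w \<in> words m \<Longrightarrow> j < m \<Longrightarrow> w @ [j] \<in> words m"
  by (auto simp: words_def)

lemma povm_cylinder_additive:
  assumes "povm m E"
  shows "cinner (E (cylinder m w) x) y = (\<Sum>j<m. cinner (E (cylinder m (w @ [j])) x) y)"
proof -
  have sums: "(\<lambda>n. cinner (E (A n) x) y) sums cinner (E (\<Union>n. A n) x) y"
    if "range A \<subseteq> sets (Omega m)" "disjoint_family A" for A :: "nat \<Rightarrow> _"
    using assms that unfolding povm_def by blast
  have empty: "cinner (E {} x) y = 0"
  proof -
    have "(\<lambda>n::nat. cinner (E {} x) y) sums cinner (E {} x) y"
      using sums[of "\<lambda>_. {}"] by (simp add: disjoint_family_on_def)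
    then show ?thesis
      using sums_summable summable_const_iff by blast
  qed
  have "(\<Union>j. cylinder m (w @ [j])) = cylinder m w"
    by (auto simp: cylinder_append)
  moreover have "disjoint_family (\<lambda>j. cylinder m (w @ [j]))"
    by (auto simp: disjoint_family_on_def cylinder_append)
  ultimately have "(\<lambda>j. cinner (E (cylinder m (w @ [j])) x) y) sums cinner (E (cylinder m w) x) y"
    using sums[of "\<lambda>j. cylinder m (w @ [j])"] cylinder_in_sets by auto
  \<comment> \<open>Letters \<open>j \<ge> m\<close> occur in no sequence, so the series over all \<open>j\<close> is a finite sum.\<close>
  moreover have "cylinder m (w @ [j]) = {}" if "j \<ge> m" for j
  proof -
    have "x (length w) < m" if "x \<in> cylinder m w" for x
      using that by (simp add: cylinder_def space_Omega)
    then show ?thesis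
      using that by (force simp: cylinder_append)
  qed
  then have "(\<lambda>j. cinner (E (cylinder m (w @ [j])) x) y) sums
      (\<Sum>j<m. cinner (E (cylinder m (w @ [j])) x) y)"
    by (intro sums_finite) (auto simp: empty not_less)
  ultimately show ?thesis
    by (rule sums_unique2)
qed

section \<open>Square roots, edge contractions and their adjoints\<close>

context
  fixes m :: nat and E :: "(nat \<Rightarrow> nat) set \<Rightarrow> 'h::chilbert_space \<Rightarrow> 'h"
  assumes povm: "povm m E"
begin

lemma sqrtE:
  shows sqrtE_positive: "positive_on UNIV (sqrtE m E w)"
    and sqrtE_squared: "sqrtE m E w (sqrtE m E w h) = E (cylinder m w) h"
proof -
  have "positive_on UNIV (E (cylinder m w))"
    using povm cylinder_in_sets by (simp add: povm_def)
  from someI_ex[OF sqrt_exists[OF this]]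
  have S: "positive_on UNIV (sqrtE m E w)" "sqrtE m E w \<circ> sqrtE m E w = E (cylinder m w)"
    by (simp_all add: sqrtE_def op_sqrt_def)
  show "positive_on UNIV (sqrtE m E w)"
    by (fact S(1))
  show "sqrtE m E w (sqrtE m E w h) = E (cylinder m w) h"
    using fun_cong[OF S(2), of h] by simp
qed

lemma sqrtE_linear: "clinear_between UNIV UNIV (sqrtE m E w)"
  using sqrtE_positive by (simp add: positive_on_def bounded_between_def)

lemma sqrtE_norm_children:
  "(\<Sum>j<m. (norm (sqrtE m E (w @ [j]) h))\<^sup>2) = (norm (sqrtE m E w h))\<^sup>2"
proof -
  have norm_eq: "(norm (sqrtE m E v h))\<^sup>2 = Re (cinner (E (cylinder m v) h) h)" for v
    by (simp add: Re_cinner_self[symmetric] sqrtE_squared[symmetric]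
        positive_symmetric[OF sqrtE_positive, of v "sqrtE m E v h"])
  show ?thesis
    unfolding norm_eq povm_cylinder_additive[OF povm, of w] by simp
qed

lemma range_space_closed: "closed_csubspace (range_space m E w)"
  unfolding range_space_def by (rule closed_csubspace_closure_range[OF sqrtE_linear])

text \<open>The defining description of the edge contraction has exactly one solution: it exists because
  \<open>\<parallel>sqrtE (w @ [j]) h\<parallel> \<le> \<parallel>sqrtE w h\<parallel>\<close>, and continuity and extensionality
  make it unique.\<close>

lemma edge:
  assumes j: "j < m"
  shows edge_contraction: "contraction_between (range_space m E w) (range_space m E (w @ [j])) (edge m E w j)"
    and edge_sqrtE: "edge m E w j (sqrtE m E w h) = sqrtE m E (w @ [j]) h"
proof -
  let ?U = "range_space m E w" and ?V = "range_space m E (w @ [j])"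
  define P where "P C \<longleftrightarrow> C \<in> extensional ?U \<and> contraction_between ?U ?V C \<and>
      (\<forall>h. C (sqrtE m E w h) = sqrtE m E (w @ [j]) h)" for C
  note UD = closed_csubspaceD[OF range_space_closed[of w]]
  have le: "norm (sqrtE m E (w @ [j]) h) \<le> norm (sqrtE m E w h)" for h
  proof (rule power2_le_imp_le)
    show "(norm (sqrtE m E (w @ [j]) h))\<^sup>2 \<le> (norm (sqrtE m E w h))\<^sup>2"
      unfolding sqrtE_norm_children[of w h, symmetric] by (rule member_le_sum) (use j in auto)
  qed simp
  obtain C where C: "contraction_between ?U ?V C" "\<And>h. C (sqrtE m E w h) = sqrtE m E (w @ [j]) h"
    using contraction_extension[OF sqrtE_linear sqrtE_linear le] unfolding range_space_def by blast
  have mem: "sqrtE m E w h \<in> ?U" for h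
    unfolding range_space_def by (rule subsetD[OF closure_subset rangeI])
  have restr: "P (restrict C ?U)"
    using C mem UD(3,4) by (auto simp: P_def contraction_between_def clinear_between_def)
  have unique: "C1 = C2" if C12: "P C1" "P C2" for C1 C2
  proof (rule extensionalityI)
    show "C1 x = C2 x" if x: "x \<in> ?U" for x
      by (rule contraction_between_unique[of "sqrtE m E w" ?V])
        (use C12 x range_space_closed[of w] in \<open>simp_all add: P_def range_space_def\<close>)
  qed (use C12 in \<open>auto simp: P_def\<close>)
  have "edge m E w j = (THE C. P C)"
    by (simp only: edge_def P_def)
  also have "\<dots> = restrict C ?U"
    by (rule the_equality[of P, OF restr unique[OF _ restr]])
  finally have "P (edge m E w j)"
    using restr by (simp only:)
  then show "contraction_between ?U ?V (edge m E w j)"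
    and "edge m E w j (sqrtE m E w h) = sqrtE m E (w @ [j]) h"
    by (simp_all add: P_def)
qed

lemmas edge_bounded = contraction_between_imp_bounded[OF edge_contraction]

lemma edge_in: "j < m \<Longrightarrow> x \<in> range_space m E w \<Longrightarrow> edge m E w j x \<in> range_space m E (w @ [j])"
  using edge_contraction by (simp add: contraction_between_def clinear_between_def)

lemma edge_norm_sum:
  assumes x: "x \<in> range_space m E w"
  shows "(\<Sum>j<m. (norm (edge m E w j x))\<^sup>2) = (norm x)\<^sup>2"
proof -
  have "continuous_on (range_space m E w) (edge m E w j)" if "j < m" for j
    by (rule bounded_between_continuous_on[OF range_space_closed edge_bounded[OF that]])
  then have "continuous_on (range_space m E w) (\<lambda>x. (\<Sum>j<m. (norm (edge m E w j x))\<^sup>2) - (norm x)\<^sup>2)"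
    by (intro continuous_on_diff continuous_on_sum continuous_on_power continuous_on_norm
        continuous_on_id) simp
  moreover have "(\<Sum>j<m. (norm (edge m E w j y))\<^sup>2) - (norm y)\<^sup>2 = 0" if "y \<in> range (sqrtE m E w)" for y
    using that by (auto simp: edge_sqrtE sqrtE_norm_children)
  ultimately have "(\<Sum>j<m. (norm (edge m E w j x))\<^sup>2) - (norm x)\<^sup>2 = 0"
    using x unfolding range_space_def by (rule continuous_constant_on_closure)
  then show ?thesis by simp
qed

lemma edge_adj:
  assumes "j < m"
  shows edge_adj_in: "edge_adj m E w j y \<in> range_space m E w"
    and cinner_edge: "x \<in> range_space m E w \<Longrightarrow> cinner (edge m E w j x) y = cinner x (edge_adj m E w j y)"
  unfolding edge_adj_def by (rule hadjoint_works[OF range_space_closed edge_bounded[OF assms]])+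

lemma edge_adj_bounded: "j < m \<Longrightarrow> bounded_between V (range_space m E w) (edge_adj m E w j)"
  unfolding edge_adj_def by (rule hadjoint_bounded[OF range_space_closed edge_bounded])

lemma J_adj_eq: "J_adj m E w z = (\<Sum>j<m. edge_adj m E w j (z j))"
  unfolding J_adj_def
proof (rule hadjoint_eqI[OF range_space_closed])
  have "(\<Sum>j<n. edge_adj m E w j (z j)) \<in> range_space m E w" if "n \<le> m" for n
    using that
    by (induction n) (auto simp: edge_adj_in closed_csubspaceD[OF range_space_closed])
  then show "(\<Sum>j<m. edge_adj m E w j (z j)) \<in> range_space m E w" by simp
  show "dsum_inner m (J_op m E w x) z = cinner x (\<Sum>j<m. edge_adj m E w j (z j))"
    if "x \<in> range_space m E w" for x
    using that by (simp add: dsum_inner_def J_op_def cinner_edge cinner.sum_right)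
qed

lemma J_op_isometry:
  "isometry_between (range_space m E w) cinner (child_sum m E w) (dsum_inner m) (J_op m E w)"
  unfolding isometry_between_def
proof
  show "clinear_between (range_space m E w) (child_sum m E w) (J_op m E w)"
    using edge_contraction[of _ w]
    by (auto simp: clinear_between_def contraction_between_def J_op_def child_sum_def dsum_def
        scaleC_fun_def fun_eq_iff)
  show "\<forall>x\<in>range_space m E w. dsum_inner m (J_op m E w x) (J_op m E w x) = cinner x x"
    by (simp add: dsum_inner_def J_op_def cinner_self edge_norm_sum flip: of_real_sum of_real_power)
qed

section \<open>The local variance\<close>

context
  fixes X :: "nat list \<Rightarrow> 'h \<Rightarrow> 'h" and w :: "nat list"
  assumes mart: "bounded_range_martingale m E X" and w: "w \<in> words m"
begin

lemma martingale_selfadjoint: "v \<in> words m \<Longrightarrow> selfadjoint_on (range_space m E v) (X v)"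
  using mart by (simp add: bounded_range_martingale_def)

lemma martingale_bounded: "v \<in> words m \<Longrightarrow> bounded_between (range_space m E v) (range_space m E v) (X v)"
  using martingale_selfadjoint by (simp add: selfadjoint_on_def)

lemma martingale_in: "v \<in> words m \<Longrightarrow> x \<in> range_space m E v \<Longrightarrow> X v x \<in> range_space m E v"
  using martingale_bounded by (simp add: bounded_between_def clinear_between_def)

lemma martingale_eq:
  "x \<in> range_space m E w \<Longrightarrow> X w x = (\<Sum>j<m. edge_adj m E w j (X (w @ [j]) (edge m E w j x)))"
  using mart w by (simp add: bounded_range_martingale_def)

lemma local_variance_bounded:
  "bounded_between (range_space m E w) (range_space m E w) (local_variance m E X w)"
proof -
  have child: "bounded_between (range_space m E w) (range_space m E w)
      (\<lambda>x. edge_adj m E w j (X (w @ [j]) (X (w @ [j]) (edge m E w j x))))" if "j < m" for j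
    using bounded_between_compose[OF bounded_between_compose[OF bounded_between_compose[OF
          edge_bounded[OF that] martingale_bounded] martingale_bounded] edge_adj_bounded[OF that]]
      append_in_words[OF w that] by blast
  show ?thesis
    unfolding local_variance_def[abs_def]
    by (intro bounded_between_diff bounded_between_sum range_space_closed child
        bounded_between_compose[OF martingale_bounded[OF w] martingale_bounded[OF w]])
qed

text \<open>The form of the local variance at \<open>x\<close> is \<open>\<parallel>Y J x - J X\<^sub>w x\<parallel>\<^sup>2\<close>, the squared distance from
  \<open>Y J x\<close> to the range of \<open>J\<close>.\<close>

lemma local_variance_quadratic_form:
  assumes x: "x \<in> range_space m E w"
  shows "cinner (local_variance m E X w x) x =
    complex_of_real (\<Sum>j<m. (norm (X (w @ [j]) (edge m E w j x) - edge m E w j (X w x)))\<^sup>2)"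
proof -
  define y where "y j = X (w @ [j]) (edge m E w j x)" for j
  define u where "u = X w x"
  have u: "u \<in> range_space m E w"
    unfolding u_def by (rule martingale_in[OF w x])
  have y: "y j \<in> range_space m E (w @ [j])" if "j < m" for j
    unfolding y_def by (rule martingale_in[OF append_in_words[OF w that] edge_in[OF that x]])
  have u_eq: "u = (\<Sum>j<m. edge_adj m E w j (y j))"
    unfolding u_def y_def by (rule martingale_eq[OF x])
  have adj: "cinner (edge_adj m E w j z) v = cinner z (edge m E w j v)"
    if "j < m" "v \<in> range_space m E w" for j z v
    using cinner_edge[OF that(1,2), of z] by (metis cinner_commute)
  have "cinner (edge_adj m E w j (X (w @ [j]) (y j))) x = complex_of_real ((norm (y j))\<^sup>2)" if "j < m" for j
    using selfadjoint_on_symmetric[OF range_space_closed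
        martingale_selfadjoint[OF append_in_words[OF w that]] y[OF that] edge_in[OF that x]]
    by (simp add: adj[OF that x] cinner_self flip: y_def)
  moreover have "cinner (X w u) x = complex_of_real ((norm u)\<^sup>2)"
    using selfadjoint_on_symmetric[OF range_space_closed martingale_selfadjoint[OF w] u x]
    by (simp add: cinner_self flip: u_def)
  ultimately have form: "cinner (local_variance m E X w x) x =
      complex_of_real ((\<Sum>j<m. (norm (y j))\<^sup>2) - (norm u)\<^sup>2)"
    by (simp add: local_variance_def cinner.diff_left cinner.sum_left flip: y_def u_def)
  \<comment> \<open>The martingale identity \<open>u = J\<^sup>* y\<close> turns the cross term into \<open>\<parallel>u\<parallel>\<^sup>2\<close>.\<close>
  have "(\<Sum>j<m. Re (cinner (y j) (edge m E w j u))) = Re (cinner (\<Sum>j<m. edge_adj m E w j (y j)) u)"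
    by (simp add: cinner.sum_left adj u)
  also have "\<dots> = (norm u)\<^sup>2"
    by (simp add: Re_cinner_self flip: u_eq)
  finally have cross: "(\<Sum>j<m. Re (cinner (y j) (edge m E w j u))) = (norm u)\<^sup>2" .
  have "(\<Sum>j<m. (norm (y j - edge m E w j u))\<^sup>2) =
      (\<Sum>j<m. (norm (y j))\<^sup>2) - 2 * (\<Sum>j<m. Re (cinner (y j) (edge m E w j u)))
      + (\<Sum>j<m. (norm (edge m E w j u))\<^sup>2)"
    by (simp add: norm_diff_square sum.distrib sum_subtractf sum_distrib_left)
  also have "\<dots> = (\<Sum>j<m. (norm (y j))\<^sup>2) - (norm u)\<^sup>2"
    by (simp add: cross edge_norm_sum[OF u])
  finally show ?thesis
    unfolding form y_def u_def by simp
qed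

lemma local_variance_factorization:
  assumes x: "x \<in> range_space m E w"
  shows "local_variance m E X w x =
    (J_adj m E w \<circ> Y_op m X w \<circ> (\<lambda>z. z - J_op m E w (J_adj m E w z)) \<circ> Y_op m X w \<circ> J_op m E w) x"
proof -
  define u where "u = X w x"
  have u: "u \<in> range_space m E w"
    unfolding u_def by (rule martingale_in[OF w x])
  define y where "y = Y_op m X w (J_op m E w x)"
  have y: "y j = X (w @ [j]) (edge m E w j x)" if "j < m" for j
    using that by (simp add: y_def Y_op_def J_op_def)
  have JYJ: "J_adj m E w (Y_op m X w (J_op m E w v)) = X w v" if "v \<in> range_space m E w" for v
    unfolding J_adj_eq martingale_eq[OF that] by (simp add: Y_op_def J_op_def)
  have "(J_adj m E w \<circ> Y_op m X w \<circ> (\<lambda>z. z - J_op m E w (J_adj m E w z)) \<circ> Y_op m X w \<circ> J_op m E w) x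
      = (\<Sum>j<m. edge_adj m E w j (X (w @ [j]) (y j - edge m E w j u)))"
    by (simp add: J_adj_eq[of w "Y_op m X w (y - J_op m E w u)"] JYJ[OF x, folded y_def u_def]
        flip: y_def) (simp add: Y_op_def J_op_def)
  also have "\<dots> = (\<Sum>j<m. edge_adj m E w j (X (w @ [j]) (y j)) - edge_adj m E w j (X (w @ [j]) (edge m E w j u)))"
  proof (rule sum.cong[OF refl])
    fix j assume "j \<in> {..<m}"
    then have j: "j < m" by simp
    let ?V = "range_space m E (w @ [j])"
    note wj = append_in_words[OF w j]
    have lin: "clinear_between ?V (range_space m E w) (\<lambda>z. edge_adj m E w j (X (w @ [j]) z))"
      using bounded_between_compose[OF martingale_bounded[OF wj] edge_adj_bounded[OF j]]
      by (simp add: bounded_between_def)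
    have "y j \<in> ?V"
      unfolding y[OF j] by (rule martingale_in[OF wj edge_in[OF j x]])
    then show "edge_adj m E w j (X (w @ [j]) (y j - edge m E w j u)) =
        edge_adj m E w j (X (w @ [j]) (y j)) - edge_adj m E w j (X (w @ [j]) (edge m E w j u))"
      by (rule clinear_between_diff[OF range_space_closed lin _ edge_in[OF j u]])
  qed
  also have "\<dots> = local_variance m E X w x"
    unfolding sum_subtractf martingale_eq[OF u, symmetric]
    by (simp add: local_variance_def y u_def)
  finally show ?thesis ..
qed

end

end

theorem lemma7p2:
  fixes m :: nat
    and E :: "(nat \<Rightarrow> nat) set \<Rightarrow> 'h::chilbert_space \<Rightarrow> 'h"
    and X :: "nat list \<Rightarrow> 'h \<Rightarrow> 'h"
    and w :: "nat list"
  assumes "2 \<le> m"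
    and "povm m E"
    and "bounded_range_martingale m E X"
    and "w \<in> words m"
  shows "positive_on (range_space m E w) (local_variance m E X w) \<and>
    isometry_between (range_space m E w) cinner (child_sum m E w) (dsum_inner m) (J_op m E w) \<and>
    (\<forall>x\<in>range_space m E w.
       local_variance m E X w x =
         (J_adj m E w \<circ> Y_op m X w \<circ> (\<lambda>z. z - J_op m E w (J_adj m E w z)) \<circ> Y_op m X w \<circ> J_op m E w) x)"
proof (intro conjI ballI)
  note asms = assms(2-4)
  show "positive_on (range_space m E w) (local_variance m E X w)"
    unfolding positive_on_def
    using local_variance_bounded[OF asms] local_variance_quadratic_form[OF asms]
    by (simp add: sum_nonneg del: of_real_sum)
  show "isometry_between (range_space m E w) cinner (child_sum m E w) (dsum_inner m) (J_op m E w)"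
    by (rule J_op_isometry[OF asms(1)])
  show "local_variance m E X w x =
      (J_adj m E w \<circ> Y_op m X w \<circ> (\<lambda>z. z - J_op m E w (J_adj m E w z)) \<circ> Y_op m X w \<circ> J_op m E w) x"
    if "x \<in> range_space m E w" for x
    by (rule local_variance_factorization[OF asms that])
qed

end
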